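(* Let $U:\mathbb R\to[0,1]$ be a measurable function with $\mathbb E_\xi[\xi U(\xi)]\neq 0$. If in addition $U$ is bounded away from zero, or compactly supported, or logconcave, then $$\sup\Big\{\frac{\mathbb E_{\xi,\xi'}[(\xi-\xi')^2U(x+c\xi)U(x+c\xi')]}{\mathbb E_{\xi,\xi'}[U(x+c\xi)U(x+c\xi')]}:x\in\mathbb R,\ \tfrac25\le c\le\tfrac73\Big\}<\infty .$$
   Context: $\xi,\xi'$ are independent standard Gaussian random variables; $\mathbb E_\xi$ and $\mathbb E_{\xi,\xi'}$ denote expectation over them. Bounded away from zero means $\inf_{x}U(x)>0$. *)

theory Defs
  imports "HOL-Probability.Probability"
begin

text \<open>
  Multiplicative form of logconcavity, so that functions with zeros are covered
  (log 0 is to be read as minus infinity). The weight t ranges over the open unit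
  interval: the inequality is trivial at the endpoints, and \<open>0 powr t = 0\<close>.
\<close>

definition logconcave :: "(real \<Rightarrow> real) \<Rightarrow> bool" where
  "logconcave U \<longleftrightarrow>
     (\<forall>x. U x \<ge> 0) \<and>
     (\<forall>x y. \<forall>t\<in>{0<..<1}. U ((1 - t) * x + t * y) \<ge> U x powr (1 - t) * U y powr t)"

definition compactly_supported :: "(real \<Rightarrow> real) \<Rightarrow> bool" where
  "compactly_supported U \<longleftrightarrow> compact (closure {x. U x \<noteq> 0})"

definition bounded_away_from_zero :: "(real \<Rightarrow> real) \<Rightarrow> bool" where
  "bounded_away_from_zero U \<longleftrightarrow> (INF x. U x) > 0"

end

theory Submission
  imports Defs
begin

text \<open>
  It suffices to find a constant \<open>K\<close>, independent of \<open>x\<close> and \<open>c\<close>, such that the numerator is at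
  most \<open>K\<close> times the denominator.

  If \<open>U \<ge> \<delta> > 0\<close>, then the numerator is at most \<open>E (\<xi> - \<xi>')\<^sup>2\<close> and the denominator at least \<open>\<delta>\<^sup>2\<close>.
  If \<open>U\<close> vanishes outside \<open>[-B, B]\<close>, then \<open>U (x + c * \<xi>) * U (x + c * \<xi>') \<noteq> 0\<close> forces
  \<open>c * \<bar>\<xi> - \<xi>'\<bar> \<le> 2 * B\<close>; since \<open>c \<ge> 2/5\<close>, this bounds \<open>(\<xi> - \<xi>')\<^sup>2\<close> wherever the integrand is nonzero.

  The logconcave case is a one-dimensional Brascamp-Lieb inequality, with \<open>K = 2\<close>: replacing \<open>U\<close> by
  \<open>V z = U (x + c * z)\<close>, which is again logconcave, the claim is that the weight \<open>V\<close> does not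
  increase the variance of a Gaussian. In the variables
  \<open>m = (\<xi> + \<xi>') / 2\<close> and \<open>w = \<xi> - \<xi>'\<close> the law of the pair is still a product of Gaussians
  (lemma \<open>nn_expectation_midpoint_difference\<close>), and for fixed \<open>m\<close> the function
  \<open>w \<mapsto> V (m + w/2) * V (m - w/2)\<close> is even and decreasing in \<open>\<bar>w\<bar>\<close>
  (lemma \<open>logconcave_mirrored_product_antimono\<close>). As \<open>w\<^sup>2\<close> increases in \<open>\<bar>w\<bar>\<close>, the two are negatively
  correlated (lemma \<open>normal_second_moment_antimono_weight\<close>), while \<open>E w\<^sup>2 = 2\<close>.
\<close>

section \<open>Logconcave functions\<close>

lemma logconcave_affine:
  assumes "logconcave U"
  shows "logconcave (\<lambda>z. U (x + c * z))"
proof -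
  have "x + c * ((1 - t) * y + t * z) = (1 - t) * (x + c * y) + t * (x + c * z)" for y z t
    by (simp add: algebra_simps)
  then show ?thesis
    using assms unfolding logconcave_def by simp
qed

text \<open>
  The points \<open>m + s\<close> and \<open>m - s\<close> divide the segment from \<open>m + r\<close> to \<open>m - r\<close> in the ratios \<open>t : 1 - t\<close>
  and \<open>1 - t : t\<close>. In the product of the two logconcavity inequalities the exponents of each factor
  add up to one.
\<close>

lemma logconcave_mirrored_product_antimono:
  fixes m r s :: real
  assumes V: "logconcave V" and rs: "\<bar>s\<bar> \<le> \<bar>r\<bar>"
  shows "V (m + r) * V (m - r) \<le> V (m + s) * V (m - s)"
proof (cases "\<bar>s\<bar> = \<bar>r\<bar>")
  case True
  then have "s = r \<or> s = - r" by linarith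
  then show ?thesis by auto
next
  case False
  with rs have sr: "\<bar>s\<bar> < \<bar>r\<bar>" by simp
  then have r0: "r \<noteq> 0" by auto
  define t where "t = (1 - s / r) / 2"
  have "\<bar>s / r\<bar> < 1"
    using sr r0 by (simp add: abs_divide)
  then have t: "t \<in> {0<..<1}" and t': "1 - t \<in> {0<..<1}"
    unfolding t_def abs_less_iff by auto
  have "(1 - 2 * t) * r = s"
    using r0 by (simp add: t_def diff_divide_distrib)
  then have plus: "m + s = (1 - t) * (m + r) + t * (m - r)"
    and minus: "m - s = (1 - (1 - t)) * (m + r) + (1 - t) * (m - r)"
    by (simp_all add: algebra_simps)
  have nonneg: "V z \<ge> 0" for z
    using V by (simp add: logconcave_def)
  have conc: "V a powr (1 - u) * V b powr u \<le> V ((1 - u) * a + u * b)" if "u \<in> {0<..<1}" for a b u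
    using V that unfolding logconcave_def by blast
  have merge: "v powr (1 - t) * v powr t = v" if "v \<ge> 0" for v :: real
    using that by (simp add: powr_add[symmetric])
  have "V (m + r) * V (m - r)
      = (V (m + r) powr (1 - t) * V (m + r) powr t) * (V (m - r) powr (1 - t) * V (m - r) powr t)"
    by (simp only: merge[OF nonneg])
  also have "\<dots> = (V (m + r) powr (1 - t) * V (m - r) powr t) *
      (V (m + r) powr (1 - (1 - t)) * V (m - r) powr (1 - t))"
    by simp
  also have "\<dots> \<le> V (m + s) * V (m - s)"
    unfolding plus minus using conc[OF t] conc[OF t'] nonneg
    by (intro mult_mono) auto
  finally show ?thesis .
qed

section \<open>Midpoint and difference of a Gaussian pair\<close>

text \<open>
  Two translations, each applied in one variable while the other is held fixed, compose to the
  change of variables \<open>a = m + w / 2\<close>, \<open>b = m - w / 2\<close>; so no Jacobian has to be computed.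
\<close>

lemma nn_integral_midpoint_difference:
  fixes F :: "real \<Rightarrow> real \<Rightarrow> ennreal"
  assumes F[measurable]: "case_prod F \<in> borel_measurable (borel \<Otimes>\<^sub>M borel)"
  shows "(\<integral>\<^sup>+a. \<integral>\<^sup>+b. F a b \<partial>lborel \<partial>lborel) = (\<integral>\<^sup>+m. \<integral>\<^sup>+w. F (m + w / 2) (m - w / 2) \<partial>lborel \<partial>lborel)"
proof -
  have "(\<integral>\<^sup>+a. \<integral>\<^sup>+b. F a b \<partial>lborel \<partial>lborel) = (\<integral>\<^sup>+b. \<integral>\<^sup>+a. F a b \<partial>lborel \<partial>lborel)"
    by (rule lborel_pair.Fubini'[symmetric]) measurable
  also have "\<dots> = (\<integral>\<^sup>+b. \<integral>\<^sup>+w. F (b + w) b \<partial>lborel \<partial>lborel)"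
  proof (rule nn_integral_cong)
    fix b :: real
    show "(\<integral>\<^sup>+a. F a b \<partial>lborel) = (\<integral>\<^sup>+w. F (b + w) b \<partial>lborel)"
      by (subst nn_integral_real_affine[where c = 1 and t = b]) measurable
  qed
  also have "\<dots> = (\<integral>\<^sup>+w. \<integral>\<^sup>+b. F (b + w) b \<partial>lborel \<partial>lborel)"
    by (rule lborel_pair.Fubini'[symmetric]) measurable
  also have "\<dots> = (\<integral>\<^sup>+w. \<integral>\<^sup>+m. F (m + w / 2) (m - w / 2) \<partial>lborel \<partial>lborel)"
  proof (rule nn_integral_cong)
    fix w :: real
    have "(\<integral>\<^sup>+b. F (b + w) b \<partial>lborel) = (\<integral>\<^sup>+m. F (- (w / 2) + 1 * m + w) (- (w / 2) + 1 * m) \<partial>lborel)"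
      by (subst nn_integral_real_affine[where c = 1 and t = "- (w / 2)"]) measurable
    also have "\<dots> = (\<integral>\<^sup>+m. F (m + w / 2) (m - w / 2) \<partial>lborel)"
      by (intro nn_integral_cong arg_cong2[where f = F]) (simp_all add: field_simps)
    finally show "(\<integral>\<^sup>+b. F (b + w) b \<partial>lborel) = (\<integral>\<^sup>+m. F (m + w / 2) (m - w / 2) \<partial>lborel)" .
  qed
  also have "\<dots> = (\<integral>\<^sup>+m. \<integral>\<^sup>+w. F (m + w / 2) (m - w / 2) \<partial>lborel \<partial>lborel)"
    by (rule lborel_pair.Fubini'[symmetric]) measurable
  finally show ?thesis .
qed

lemma std_normal_density_midpoint_difference:
  "std_normal_density (m + w / 2) * std_normal_density (m - w / 2) =
    normal_density 0 (1 / sqrt 2) m * normal_density 0 (sqrt 2) w"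
proof -
  have "- (m + w / 2)\<^sup>2 / 2 + - (m - w / 2)\<^sup>2 / 2 = - m\<^sup>2 + - w\<^sup>2 / 4"
    by (simp add: power2_eq_square field_simps)
  then have e: "exp (- (m + w / 2)\<^sup>2 / 2) * exp (- (m - w / 2)\<^sup>2 / 2) = exp (- m\<^sup>2) * exp (- w\<^sup>2 / 4)"
    by (simp only: exp_add[symmetric])
  have c: "1 / sqrt (2 * pi) * (1 / sqrt (2 * pi)) = 1 / sqrt pi * (1 / sqrt (4 * pi))"
    by (simp add: real_sqrt_mult field_simps)
  have "std_normal_density (m + w / 2) * std_normal_density (m - w / 2) =
    (1 / sqrt (2 * pi) * (1 / sqrt (2 * pi))) * (exp (- (m + w / 2)\<^sup>2 / 2) * exp (- (m - w / 2)\<^sup>2 / 2))"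
    by (simp only: std_normal_density_def mult_ac)
  also have "\<dots> = normal_density 0 (1 / sqrt 2) m * normal_density 0 (sqrt 2) w"
    unfolding e c normal_density_def by (simp add: power_divide)
  finally show ?thesis .
qed

lemma (in prob_space) std_normal_pair_distributed:
  fixes X Y :: "'a \<Rightarrow> real"
  assumes X: "distributed M lborel X std_normal_density"
    and Y: "distributed M lborel Y std_normal_density"
    and indep: "indep_var borel X borel Y"
  shows "distributed M (lborel \<Otimes>\<^sub>M lborel) (\<lambda>\<omega>. (X \<omega>, Y \<omega>))
      (\<lambda>(a, b). ennreal (std_normal_density a) * ennreal (std_normal_density b))"
proof (rule distributed_joint_indep[OF lborel.sigma_finite_measure_axioms
      lborel.sigma_finite_measure_axioms X Y])
  show "indep_var lborel X lborel Y"
    using indep unfolding indep_var_eq by simp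
qed

lemma (in prob_space) nn_expectation_midpoint_difference:
  fixes X Y :: "'a \<Rightarrow> real" and H :: "real \<Rightarrow> real \<Rightarrow> ennreal"
  assumes X: "distributed M lborel X std_normal_density"
    and Y: "distributed M lborel Y std_normal_density"
    and indep: "indep_var borel X borel Y"
    and H[measurable]: "case_prod H \<in> borel_measurable (borel \<Otimes>\<^sub>M borel)"
  shows "(\<integral>\<^sup>+\<omega>. H (X \<omega>) (Y \<omega>) \<partial>M) =
    (\<integral>\<^sup>+m. \<integral>\<^sup>+w. ennreal (normal_density 0 (1 / sqrt 2) m * normal_density 0 (sqrt 2) w) *
        H (m + w / 2) (m - w / 2) \<partial>lborel \<partial>lborel)"
proof -
  let ?d = "\<lambda>a b. ennreal (std_normal_density a) * ennreal (std_normal_density b)"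
  have H': "case_prod H \<in> borel_measurable (lborel \<Otimes>\<^sub>M lborel)"
    using H by (simp cong: measurable_cong_sets)
  have dH: "(\<lambda>(a, b). ?d a b * H a b) \<in> borel_measurable (borel \<Otimes>\<^sub>M borel)"
    by measurable
  have dH': "(\<lambda>(a, b). ?d a b * H a b) \<in> borel_measurable (lborel \<Otimes>\<^sub>M lborel)"
    using dH by (simp cong: measurable_cong_sets)
  have "(\<integral>\<^sup>+\<omega>. H (X \<omega>) (Y \<omega>) \<partial>M) =
      (\<integral>\<^sup>+p. (case p of (a, b) \<Rightarrow> ?d a b) * case_prod H p \<partial>(lborel \<Otimes>\<^sub>M lborel))"
    using distributed_nn_integral[OF std_normal_pair_distributed[OF X Y indep] H'] by simp
  also have "\<dots> = (\<integral>\<^sup>+p. (case p of (a, b) \<Rightarrow> ?d a b * H a b) \<partial>(lborel \<Otimes>\<^sub>M lborel))"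
    by (intro nn_integral_cong) (simp split: prod.split)
  also have "\<dots> = (\<integral>\<^sup>+a. \<integral>\<^sup>+b. ?d a b * H a b \<partial>lborel \<partial>lborel)"
    using lborel.nn_integral_fst[OF dH'] by simp
  also have "\<dots> = (\<integral>\<^sup>+m. \<integral>\<^sup>+w. ?d (m + w / 2) (m - w / 2) * H (m + w / 2) (m - w / 2) \<partial>lborel \<partial>lborel)"
    using nn_integral_midpoint_difference[OF dH] by simp
  finally show ?thesis
    by (simp add: ennreal_mult'[symmetric] std_normal_density_midpoint_difference)
qed

section \<open>Variance under a unimodal or logconcave weight\<close>

text \<open>
  Chebyshev's association inequality, anchored at \<open>\<sigma>\<close>: the factors \<open>w\<^sup>2 - \<sigma>\<^sup>2\<close> and \<open>W w - W \<sigma>\<close> have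
  opposite signs at every \<open>w\<close>, and \<open>w\<^sup>2 - \<sigma>\<^sup>2\<close> has Gaussian mean zero.
\<close>

lemma normal_second_moment_antimono_weight:
  fixes W :: "real \<Rightarrow> real"
  assumes \<sigma>: "\<sigma> > 0" and W[measurable]: "W \<in> borel_measurable borel"
    and bounds: "\<And>w. 0 \<le> W w" "\<And>w. W w \<le> C"
    and anti: "\<And>u w. \<bar>u\<bar> \<le> \<bar>w\<bar> \<Longrightarrow> W w \<le> W u"
  shows "(\<integral>\<^sup>+w. ennreal (normal_density 0 \<sigma> w * (w\<^sup>2 * W w)) \<partial>lborel) \<le>
    (\<integral>\<^sup>+w. ennreal (normal_density 0 \<sigma> w * (\<sigma>\<^sup>2 * W w)) \<partial>lborel)"
proof -
  let ?n = "normal_density 0 \<sigma>"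
  have int2: "has_bochner_integral lborel (\<lambda>w. ?n w * w\<^sup>2) (\<sigma>\<^sup>2)"
    using normal_moment_even[OF \<sigma>, of 0 1] by simp
  have int0: "has_bochner_integral lborel ?n 1"
    using integrable_normal_density[OF \<sigma>, of 0] integral_normal_density[OF \<sigma>, of 0]
    by (simp add: has_bochner_integral_iff)
  have "C \<ge> 0"
    using bounds(1)[of 0] bounds(2)[of 0] by linarith
  have i2: "integrable lborel (\<lambda>w. ?n w * (w\<^sup>2 * W w))"
  proof (rule Bochner_Integration.integrable_bound)
    show "integrable lborel (\<lambda>w. ?n w * w\<^sup>2 * C)"
      using int2 by (intro integrable_mult_left) (auto simp: has_bochner_integral_iff)
    show "AE w in lborel. norm (?n w * (w\<^sup>2 * W w)) \<le> norm (?n w * w\<^sup>2 * C)"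
      using bounds \<open>C \<ge> 0\<close> by (intro AE_I2) (auto simp: abs_mult mult.assoc intro!: mult_left_mono)
  qed measurable
  have i0: "integrable lborel (\<lambda>w. ?n w * (\<sigma>\<^sup>2 * W w))"
  proof (rule Bochner_Integration.integrable_bound)
    show "integrable lborel (\<lambda>w. ?n w * (\<sigma>\<^sup>2 * C))"
      using int0 by (intro integrable_mult_left) (auto simp: has_bochner_integral_iff)
    show "AE w in lborel. norm (?n w * (\<sigma>\<^sup>2 * W w)) \<le> norm (?n w * (\<sigma>\<^sup>2 * C))"
      using bounds \<open>C \<ge> 0\<close> by (intro AE_I2) (auto simp: abs_mult intro!: mult_left_mono)
  qed measurable
  have anchor: "has_bochner_integral lborel (\<lambda>w. (?n w * w\<^sup>2 - ?n w * \<sigma>\<^sup>2) * W \<sigma>) ((\<sigma>\<^sup>2 - 1 * \<sigma>\<^sup>2) * W \<sigma>)"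
    by (intro has_bochner_integral_mult_left has_bochner_integral_diff int2 int0)
  have "(\<integral>w. ?n w * (w\<^sup>2 * W w) \<partial>lborel) - (\<integral>w. ?n w * (\<sigma>\<^sup>2 * W w) \<partial>lborel)
      = (\<integral>w. ?n w * (w\<^sup>2 * W w) - ?n w * (\<sigma>\<^sup>2 * W w) \<partial>lborel)"
    using i2 i0 by simp
  also have "\<dots> \<le> (\<integral>w. (?n w * w\<^sup>2 - ?n w * \<sigma>\<^sup>2) * W \<sigma> \<partial>lborel)"
  proof (rule integral_mono)
    show "integrable lborel (\<lambda>w. ?n w * (w\<^sup>2 * W w) - ?n w * (\<sigma>\<^sup>2 * W w))"
      using i2 i0 by simp
    show "integrable lborel (\<lambda>w. (?n w * w\<^sup>2 - ?n w * \<sigma>\<^sup>2) * W \<sigma>)"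
      using anchor by (simp add: has_bochner_integral_iff)
    fix w :: real
    have "(w\<^sup>2 - \<sigma>\<^sup>2) * (W w - W \<sigma>) \<le> 0"
    proof (cases "\<bar>w\<bar> \<le> \<bar>\<sigma>\<bar>")
      case True
      then show ?thesis
        using anti[OF True] by (intro mult_nonpos_nonneg) (auto simp: abs_le_square_iff)
    next
      case False
      then have "\<bar>\<sigma>\<bar> \<le> \<bar>w\<bar>" by simp
      then show ?thesis
        using anti[of \<sigma> w] by (intro mult_nonneg_nonpos) (auto simp: abs_le_square_iff)
    qed
    then have "?n w * ((w\<^sup>2 - \<sigma>\<^sup>2) * (W w - W \<sigma>)) \<le> 0"
      by (simp add: mult_nonneg_nonpos)
    then show "?n w * (w\<^sup>2 * W w) - ?n w * (\<sigma>\<^sup>2 * W w) \<le> (?n w * w\<^sup>2 - ?n w * \<sigma>\<^sup>2) * W \<sigma>"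
      by (simp add: algebra_simps)
  qed
  also have "\<dots> = 0"
    using anchor by (simp add: has_bochner_integral_iff)
  finally have "(\<integral>w. ?n w * (w\<^sup>2 * W w) \<partial>lborel) \<le> (\<integral>w. ?n w * (\<sigma>\<^sup>2 * W w) \<partial>lborel)"
    by simp
  then show ?thesis
    using i2 i0 bounds by (simp add: nn_integral_eq_integral ennreal_leI)
qed

lemma (in prob_space) integrable_std_normal_square_diff:
  fixes X Y :: "'a \<Rightarrow> real"
  assumes X: "distributed M lborel X std_normal_density"
    and Y: "distributed M lborel Y std_normal_density"
  shows "integrable M (\<lambda>\<omega>. (X \<omega> - Y \<omega>)\<^sup>2)"
proof (rule Bochner_Integration.integrable_bound)
  have [measurable]: "random_variable borel X" "random_variable borel Y"
    using distributed_measurable[OF X] distributed_measurable[OF Y] by simp_all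
  have "integrable M (\<lambda>\<omega>. (Z \<omega>)\<^sup>2)" if Z: "distributed M lborel Z std_normal_density" for Z :: "'a \<Rightarrow> real"
    using distributed_integrable[OF Z, of power2] integrable_normal_moment[of 1 0 2] by simp
  then show "integrable M (\<lambda>\<omega>. 2 * (X \<omega>)\<^sup>2 + 2 * (Y \<omega>)\<^sup>2)"
    using X Y by simp
  show "(\<lambda>\<omega>. (X \<omega> - Y \<omega>)\<^sup>2) \<in> borel_measurable M"
    by measurable
  have "(a - b)\<^sup>2 \<le> 2 * a\<^sup>2 + 2 * b\<^sup>2" for a b :: real
    using zero_le_power2[of "a + b"] by (simp add: power2_eq_square algebra_simps)
  then show "AE \<omega> in M. norm ((X \<omega> - Y \<omega>)\<^sup>2) \<le> norm (2 * (X \<omega>)\<^sup>2 + 2 * (Y \<omega>)\<^sup>2)"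
    by (intro AE_I2) simp
qed

text \<open>
  The constant 2 is the variance of \<open>X - Y\<close>, attained by constant weights: dividing by twice the
  squared mass of \<open>V\<close> turns the inequality into the bound 1 for the variance of the Gaussian with
  density weighted by \<open>V\<close>.
\<close>

lemma (in prob_space) logconcave_weighted_variance:
  fixes X Y :: "'a \<Rightarrow> real" and V :: "real \<Rightarrow> real"
  assumes X: "distributed M lborel X std_normal_density"
    and Y: "distributed M lborel Y std_normal_density"
    and indep: "indep_var borel X borel Y"
    and V[measurable]: "V \<in> borel_measurable borel"
    and le1: "\<And>z. V z \<le> 1" and lc: "logconcave V"
  shows "expectation (\<lambda>\<omega>. (X \<omega> - Y \<omega>)\<^sup>2 * V (X \<omega>) * V (Y \<omega>)) \<le>
    2 * expectation (\<lambda>\<omega>. V (X \<omega>) * V (Y \<omega>))"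
proof -
  have [measurable]: "random_variable borel X" "random_variable borel Y"
    using distributed_measurable[OF X] distributed_measurable[OF Y] by simp_all
  have nonneg: "V z \<ge> 0" for z
    using lc by (simp add: logconcave_def)
  have prod_le1: "V a * V b \<le> 1" for a b
    using mult_mono[OF le1[of a] le1[of b]] nonneg by simp
  have i0: "integrable M (\<lambda>\<omega>. V (X \<omega>) * V (Y \<omega>))"
    by (rule integrable_const_bound[where B = 1]) (use nonneg prod_le1 in \<open>auto simp: abs_mult\<close>)
  have i2: "integrable M (\<lambda>\<omega>. (X \<omega> - Y \<omega>)\<^sup>2 * V (X \<omega>) * V (Y \<omega>))"
  proof (rule Bochner_Integration.integrable_bound[OF integrable_std_normal_square_diff[OF X Y]])
    show "AE \<omega> in M. norm ((X \<omega> - Y \<omega>)\<^sup>2 * V (X \<omega>) * V (Y \<omega>)) \<le> norm ((X \<omega> - Y \<omega>)\<^sup>2)"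
      using nonneg prod_le1 by (intro AE_I2) (simp add: abs_mult mult.assoc mult_left_le)
  qed measurable
  let ?k = "normal_density 0 (1 / sqrt 2)" and ?n = "normal_density 0 (sqrt 2)"
  let ?W = "\<lambda>m w. V (m + w / 2) * V (m - w / 2)"
  have "ennreal (expectation (\<lambda>\<omega>. (X \<omega> - Y \<omega>)\<^sup>2 * V (X \<omega>) * V (Y \<omega>))) =
      (\<integral>\<^sup>+\<omega>. ennreal ((X \<omega> - Y \<omega>)\<^sup>2 * V (X \<omega>) * V (Y \<omega>)) \<partial>M)"
    using i2 nonneg by (simp add: nn_integral_eq_integral)
  also have "\<dots> = (\<integral>\<^sup>+m. \<integral>\<^sup>+w. ennreal (?k m * ?n w) * ennreal (w\<^sup>2 * V (m + w / 2) * V (m - w / 2))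
      \<partial>lborel \<partial>lborel)"
    by (subst nn_expectation_midpoint_difference[OF X Y indep,
          where H = "\<lambda>a b. ennreal ((a - b)\<^sup>2 * V a * V b)"]) measurable
  also have "\<dots> = (\<integral>\<^sup>+m. ennreal (?k m) * (\<integral>\<^sup>+w. ennreal (?n w * (w\<^sup>2 * ?W m w)) \<partial>lborel) \<partial>lborel)"
    by (intro nn_integral_cong, subst nn_integral_cmult[symmetric])
      (simp_all add: ennreal_mult'[symmetric] mult_ac)
  also have "\<dots> \<le> (\<integral>\<^sup>+m. ennreal (?k m) * (\<integral>\<^sup>+w. ennreal (?n w * ((sqrt 2)\<^sup>2 * ?W m w)) \<partial>lborel) \<partial>lborel)"
  proof (rule nn_integral_mono, rule mult_left_mono)
    fix m :: real
    show "(\<integral>\<^sup>+w. ennreal (?n w * (w\<^sup>2 * ?W m w)) \<partial>lborel) \<le>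
        (\<integral>\<^sup>+w. ennreal (?n w * ((sqrt 2)\<^sup>2 * ?W m w)) \<partial>lborel)"
    proof (rule normal_second_moment_antimono_weight[where C = 1])
      show "?W m w \<le> ?W m u" if "\<bar>u\<bar> \<le> \<bar>w\<bar>" for u w
        using that by (intro logconcave_mirrored_product_antimono[OF lc]) simp
    qed (use nonneg prod_le1 in \<open>auto\<close>)
  qed simp
  also have "\<dots> = (\<integral>\<^sup>+m. \<integral>\<^sup>+w. ennreal (?k m * ?n w) * ennreal (2 * (V (m + w / 2) * V (m - w / 2)))
      \<partial>lborel \<partial>lborel)"
    by (intro nn_integral_cong, subst nn_integral_cmult[symmetric])
      (simp_all add: ennreal_mult'[symmetric] mult_ac)
  also have "\<dots> = (\<integral>\<^sup>+\<omega>. ennreal (2 * (V (X \<omega>) * V (Y \<omega>))) \<partial>M)"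
    by (subst nn_expectation_midpoint_difference[OF X Y indep,
          where H = "\<lambda>a b. ennreal (2 * (V a * V b))"]) measurable
  also have "\<dots> = ennreal (2 * expectation (\<lambda>\<omega>. V (X \<omega>) * V (Y \<omega>)))"
    using i0 nonneg by (subst nn_integral_eq_integral) auto
  finally show ?thesis
    using nonneg by (subst (asm) ennreal_le_iff) (auto intro!: integral_nonneg_AE)
qed

section \<open>The three cases\<close>

theorem proposition1p4:
  fixes M :: "'a measure" and \<xi> \<xi>' :: "'a \<Rightarrow> real" and U :: "real \<Rightarrow> real"
  assumes "prob_space M"
    and "distributed M lborel \<xi> std_normal_density"
    and "distributed M lborel \<xi>' std_normal_density"
    and "prob_space.indep_var M borel \<xi> borel \<xi>'"
    and "U \<in> borel_measurable borel"
    and "\<And>x. U x \<in> {0..1}"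
    and "prob_space.expectation M (\<lambda>\<omega>. \<xi> \<omega> * U (\<xi> \<omega>)) \<noteq> 0"
    and "bounded_away_from_zero U \<or> compactly_supported U \<or> logconcave U"
  shows "(SUP (x, c) \<in> (UNIV :: real set) \<times> {2/5..7/3}.
            ereal (prob_space.expectation M
                     (\<lambda>\<omega>. (\<xi> \<omega> - \<xi>' \<omega>)\<^sup>2 * U (x + c * \<xi> \<omega>) * U (x + c * \<xi>' \<omega>))
                 / prob_space.expectation M
                     (\<lambda>\<omega>. U (x + c * \<xi> \<omega>) * U (x + c * \<xi>' \<omega>)))) < \<infinity>"
proof -
  interpret prob_space M by fact
  note X = assms(2) and Y = assms(3) and indep = assms(4) and U[measurable] = assms(5)
  have nonneg: "U z \<ge> 0" and le1: "U z \<le> 1" for z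
    using assms(6)[of z] by auto
  have prod_le1: "U a * U b \<le> 1" for a b
    using mult_mono[OF le1[of a] le1[of b]] nonneg by simp
  have [measurable]: "random_variable borel \<xi>" "random_variable borel \<xi>'"
    using distributed_measurable[OF X] distributed_measurable[OF Y] by simp_all
  let ?D = "\<lambda>x c. expectation (\<lambda>\<omega>. U (x + c * \<xi> \<omega>) * U (x + c * \<xi>' \<omega>))"
  let ?N = "\<lambda>x c. expectation (\<lambda>\<omega>. (\<xi> \<omega> - \<xi>' \<omega>)\<^sup>2 * U (x + c * \<xi> \<omega>) * U (x + c * \<xi>' \<omega>))"
  note isq = integrable_std_normal_square_diff[OF X Y]
  have iD: "integrable M (\<lambda>\<omega>. U (x + c * \<xi> \<omega>) * U (x + c * \<xi>' \<omega>))" for x c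
    by (rule integrable_const_bound[where B = 1]) (use nonneg prod_le1 in \<open>auto simp: abs_mult\<close>)
  have iN: "integrable M (\<lambda>\<omega>. (\<xi> \<omega> - \<xi>' \<omega>)\<^sup>2 * U (x + c * \<xi> \<omega>) * U (x + c * \<xi>' \<omega>))" for x c
  proof (rule Bochner_Integration.integrable_bound[OF isq])
    show "AE \<omega> in M. norm ((\<xi> \<omega> - \<xi>' \<omega>)\<^sup>2 * U (x + c * \<xi> \<omega>) * U (x + c * \<xi>' \<omega>)) \<le> norm ((\<xi> \<omega> - \<xi>' \<omega>)\<^sup>2)"
      using nonneg prod_le1 by (intro AE_I2) (simp add: abs_mult mult.assoc mult_left_le)
  qed measurable
  have D0: "?D x c \<ge> 0" for x c
    using nonneg by (intro integral_nonneg_AE) auto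
  have "\<exists>K\<ge>0. \<forall>x. \<forall>c\<in>{2/5..7/3}. ?N x c \<le> K * ?D x c"
    using assms(8)
  proof (elim disjE)
    assume away: "bounded_away_from_zero U"
    define \<delta> where "\<delta> = (INF x. U x)"
    have "\<delta> > 0"
      using away by (simp add: bounded_away_from_zero_def \<delta>_def)
    have "\<delta> \<le> U z" for z
      unfolding \<delta>_def using nonneg by (intro cINF_lower bdd_belowI2) auto
    then have prod_ge: "\<delta>\<^sup>2 \<le> U a * U b" for a b
      using \<open>\<delta> > 0\<close> by (simp add: power2_eq_square mult_mono nonneg)
    define Q where "Q = expectation (\<lambda>\<omega>. (\<xi> \<omega> - \<xi>' \<omega>)\<^sup>2)"
    have "Q \<ge> 0"
      unfolding Q_def by simp
    have "?N x c \<le> Q / \<delta>\<^sup>2 * ?D x c" for x c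
    proof -
      have "?N x c \<le> Q"
        unfolding Q_def using prod_le1
        by (intro integral_mono[OF iN isq]) (simp add: mult.assoc mult_left_le)
      also have "\<dots> = Q / \<delta>\<^sup>2 * \<delta>\<^sup>2"
        using \<open>\<delta> > 0\<close> by simp
      also have "\<dots> \<le> Q / \<delta>\<^sup>2 * ?D x c"
        using \<open>Q \<ge> 0\<close> prod_ge by (intro mult_left_mono integral_ge_const[OF iD]) auto
      finally show ?thesis .
    qed
    then show ?thesis
      using \<open>Q \<ge> 0\<close> by (intro exI[of _ "Q / \<delta>\<^sup>2"]) auto
  next
    assume "compactly_supported U"
    then have "bounded {x. U x \<noteq> 0}"
      unfolding compactly_supported_def by (metis bounded_subset closure_subset compact_imp_bounded)
    then obtain B where B: "\<And>z. U z \<noteq> 0 \<Longrightarrow> \<bar>z\<bar> \<le> B"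
      unfolding bounded_iff by auto
    have "(a - b)\<^sup>2 * U (x + c * a) * U (x + c * b) \<le> (5 * B)\<^sup>2 * (U (x + c * a) * U (x + c * b))"
      if c: "c \<in> {2/5..7/3}" for x c a b
    proof (cases "U (x + c * a) = 0 \<or> U (x + c * b) = 0")
      case False
      have "2/5 * \<bar>a - b\<bar> \<le> c * \<bar>a - b\<bar>"
        using c by (intro mult_right_mono) auto
      also have "\<dots> = \<bar>(x + c * a) - (x + c * b)\<bar>"
        using c by (simp add: abs_mult right_diff_distrib[symmetric])
      also have "\<dots> \<le> 2 * B"
        using B[of "x + c * a"] B[of "x + c * b"] False by linarith
      finally have "\<bar>a - b\<bar> \<le> 5 * B"
        by simp
      then have "(a - b)\<^sup>2 \<le> (5 * B)\<^sup>2"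
        by (intro abs_le_square_iff[THEN iffD1]) simp
      then show ?thesis
        unfolding mult.assoc using nonneg by (intro mult_right_mono) simp_all
    qed auto
    then have "?N x c \<le> expectation (\<lambda>\<omega>. (5 * B)\<^sup>2 * (U (x + c * \<xi> \<omega>) * U (x + c * \<xi>' \<omega>)))"
      if "c \<in> {2/5..7/3}" for x c
      using that by (intro integral_mono iN integrable_mult_right iD) blast
    then show ?thesis
      by (intro exI[of _ "(5 * B)\<^sup>2"]) auto
  next
    assume "logconcave U"
    then have "?N x c \<le> 2 * ?D x c" for x c
      using le1 by (intro logconcave_weighted_variance[OF X Y indep, of "\<lambda>z. U (x + c * z)"]
          logconcave_affine) auto
    then show ?thesis
      by (intro exI[of _ 2]) auto
  qed
  then obtain K where K: "K \<ge> 0" "\<And>x c. c \<in> {2/5..7/3} \<Longrightarrow> ?N x c \<le> K * ?D x c"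
    by blast
  \<comment> \<open>Where the denominator vanishes, the quotient is 0 by the convention for division.\<close>
  have "?N x c / ?D x c \<le> K" if "c \<in> {2/5..7/3}" for x c
  proof (cases "?D x c = 0")
    case False
    then show ?thesis
      using K(2)[OF that, of x] D0[of x c] by (simp add: divide_le_eq)
  qed (use K(1) in simp)
  then have "(SUP (x, c) \<in> (UNIV :: real set) \<times> {2/5..7/3}. ereal (?N x c / ?D x c)) \<le> ereal K"
    by (intro SUP_least) auto
  also have "\<dots> < \<infinity>"
    by simp
  finally show ?thesis .
qed

end
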